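(* Let $H\colon\mathsf{Set}\to\mathsf{Set}$ be a zippable functor, let $\mathsf{select}$ be a $\mathsf{select}$ routine (on $\mathsf{Set}$) that respects compound blocks, and let $\xi\colon X\to HX$ be an $H$-coalgebra. Then the incremental computation of $P_{i+1}$ in the partition refinement algorithm is correct, that is, for every iteration $i$, $$P_{i+1}=\ker\big(H\langle\bar q_i,q_{i+1}\rangle\cdot\xi\big)=\ker\langle H\bar q_i\cdot\xi,\;Hq_{i+1}\cdot\xi\rangle=P_i\cap\ker(Hq_{i+1}\cdot\xi).$$
   Context: A functor $H\colon\mathsf{Set}\to\mathsf{Set}$ is zippable if for all sets $A,B$ the map $\langle H(A+!),H(!+B)\rangle\colon H(A+B)\to H(A+1)\times H(1+B)$ is injective, where $!$ denotes the unique map into the one-element set $1$. For a map $f\colon X\to Y$, $\ker f=\{(x,x')\in X\times X\mid f(x)=f(x')\}$. For an equivalence relation $R$ on $X$, $\kappa_R\colon X\twoheadrightarrow X/R$ is the canonical quotient map. A $\mathsf{select}$ routine is an operation that receives a chain of surjections $X\xrightarrow{y}Y\xrightarrow{z}Z$ and returns some map $\mathsf{select}(y,z)\colon Y\to K$. It respects compound blocks if whenever $k=\mathsf{select}(y,z)$, the union $\ker z\cup\ker k$ is a kernel, i.e. an equivalence relation on $Y$. Partition refinement algorithm: given $\xi\colon X\to HX$, put $Q_0=X\times X$, $\bar q_0=\,!\colon X\to 1=K_0$, $P_0=\ker(H!\cdot\xi)$. Then for $i=0,1,2,\dots$ (while $P_i\subsetneq Q_i$) put: (1) $q_{i+1}=\mathsf{select}(\kappa_{P_i},f_i)\cdot\kappa_{P_i}\colon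 X\to K_{i+1}$, where $f_i\colon X/P_i\twoheadrightarrow X/Q_i$ is the unique map with $f_i\cdot\kappa_{P_i}=\kappa_{Q_i}$ (it exists because always $P_i\subseteq Q_i$), and $\bar q_{i+1}=\langle\bar q_i,q_{i+1}\rangle\colon X\to\prod_{j\le i+1}K_j$; (2) $Q_{i+1}=\ker\bar q_{i+1}=Q_i\cap\ker q_{i+1}$; (3) $P_{i+1}=\ker(H\bar q_{i+1}\cdot\xi)$. The optimization replaces step (3) by $P'_{i+1}=\ker\langle H\bar q_i\cdot\xi,Hq_{i+1}\cdot\xi\rangle=P_i\cap\ker(Hq_{i+1}\cdot\xi)$; correctness of the optimization means $P'_{i+1}=P_{i+1}$. *)

theory Defs
  imports Main "HOL-Library.FuncSet"
begin

section \<open>A category of sets\<close>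

text \<open>
  HOL has no type of all sets, so the category \<open>Set\<close> is rendered over a universe: its objects
  are the \<open>small\<close> subsets of a type \<open>'u\<close>, its maps from \<open>A\<close> to \<open>B\<close> are the extensional functions
  \<open>A \<rightarrow>\<^sub>E B\<close>, with composition \<open>compose\<close>. The universe carries codes for the terminal set, pairs,
  injections into disjoint unions and equivalence classes (\<open>cls\<close>), so that products, coproducts and
  quotients of small sets are again small sets of elements of \<open>'u\<close>.
  For a type of ZF sets this is the usual category of sets; closure under power sets is
  not needed and hence not required.
\<close>

record 'u set_univ =
  small :: "'u set \<Rightarrow> bool"
  pt :: 'u
  pair :: "'u \<Rightarrow> 'u \<Rightarrow> 'u"
  inl :: "'u \<Rightarrow> 'u"
  inr :: "'u \<Rightarrow> 'u"
  cls :: "'u set \<Rightarrow> 'u"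

definition one :: "'u set_univ \<Rightarrow> 'u set" where
  "one U = {pt U}"

definition bang :: "'u set_univ \<Rightarrow> 'u set \<Rightarrow> 'u \<Rightarrow> 'u" where
  "bang U A = (\<lambda>x\<in>A. pt U)"

definition prod_ob :: "'u set_univ \<Rightarrow> 'u set \<Rightarrow> 'u set \<Rightarrow> 'u set" where
  "prod_ob U A B = {pair U a b | a b. a \<in> A \<and> b \<in> B}"

definition pairing :: "'u set_univ \<Rightarrow> 'u set \<Rightarrow> ('u \<Rightarrow> 'u) \<Rightarrow> ('u \<Rightarrow> 'u) \<Rightarrow> 'u \<Rightarrow> 'u" where
  "pairing U X f g = (\<lambda>x\<in>X. pair U (f x) (g x))"

definition sum_ob :: "'u set_univ \<Rightarrow> 'u set \<Rightarrow> 'u set \<Rightarrow> 'u set" where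
  "sum_ob U A B = inl U ` A \<union> inr U ` B"

definition sum_map ::
  "'u set_univ \<Rightarrow> 'u set \<Rightarrow> 'u set \<Rightarrow> ('u \<Rightarrow> 'u) \<Rightarrow> ('u \<Rightarrow> 'u) \<Rightarrow> 'u \<Rightarrow> 'u" where
  "sum_map U A B f g = (\<lambda>t\<in>sum_ob U A B.
     if t \<in> inl U ` A then inl U (f (inv_into A (inl U) t))
     else inr U (g (inv_into B (inr U) t)))"

definition quot :: "'u set_univ \<Rightarrow> 'u set \<Rightarrow> ('u \<times> 'u) set \<Rightarrow> 'u set" where
  "quot U X R = cls U ` (X // R)"

definition kappa :: "'u set_univ \<Rightarrow> 'u set \<Rightarrow> ('u \<times> 'u) set \<Rightarrow> 'u \<Rightarrow> 'u" where
  "kappa U X R = (\<lambda>x\<in>X. cls U (R `` {x}))"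

definition kernel :: "'a set \<Rightarrow> ('a \<Rightarrow> 'b) \<Rightarrow> ('a \<times> 'a) set" where
  "kernel X f = {(x, x'). x \<in> X \<and> x' \<in> X \<and> f x = f x'}"

definition surjection :: "'u set \<Rightarrow> 'u set \<Rightarrow> ('u \<Rightarrow> 'u) \<Rightarrow> bool" where
  "surjection A B f \<longleftrightarrow> f \<in> A \<rightarrow>\<^sub>E B \<and> f ` A = B"

definition set_universe :: "'u set_univ \<Rightarrow> bool" where
  "set_universe U \<longleftrightarrow>
     small U (one U) \<and>
     (\<forall>A B. small U A \<and> B \<subseteq> A \<longrightarrow> small U B) \<and>
     (\<forall>A f. small U A \<longrightarrow> small U (f ` A)) \<and>
     (\<forall>A B. small U A \<and> small U B \<longrightarrow> small U (A \<union> B)) \<and>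
     (\<forall>A B. small U A \<and> small U B \<longrightarrow> small U (prod_ob U A B)) \<and>
     (\<forall>a b a' b'. pair U a b = pair U a' b' \<longrightarrow> a = a' \<and> b = b') \<and>
     inj (inl U) \<and> inj (inr U) \<and> range (inl U) \<inter> range (inr U) = {} \<and>
     inj_on (cls U) {A. small U A}"

text \<open>
  Every infinite type \<open>'a\<close> yields a universe over \<open>'a set\<close> whose small sets are those of
  cardinality at most that of \<open>'a\<close>; in particular there are universes with arbitrarily large
  small sets.
\<close>

lemma set_universe_of_infinite:
  assumes inf: "infinite (UNIV :: 'a set)"
  shows "\<exists>U :: 'a set set_univ. set_universe U \<and>
           (\<forall>A. small U A \<longleftrightarrow> (\<exists>f :: 'a \<Rightarrow> 'a set. A \<subseteq> range f))"
proof -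
  have "\<exists>g :: 'a \<times> 'a \<Rightarrow> 'a. bij g"
    using card_of_Times_same_infinite[OF inf] card_of_ordIso[of "UNIV \<times> UNIV" UNIV] by auto
  then obtain g :: "'a \<times> 'a \<Rightarrow> 'a" where g: "bij g" by blast
  obtain u v :: 'a where uv: "u \<noteq> v"
    using inf by (metis (full_types) finite.emptyI finite_insert finite_subset subsetI insertCI)
  define sm where "sm = (\<lambda>A :: 'a set set. \<exists>f :: 'a \<Rightarrow> 'a set. A \<subseteq> range f)"
  define tag where "tag = (\<lambda>w (a :: 'a set). (\<lambda>x. g (w, x)) ` a)"
  have g_inj: "g p = g p' \<longleftrightarrow> p = p'" for p p'
    using g by (simp add: bij_is_inj inj_eq)
  have tag_mem: "g (w, x) \<in> tag w' a \<longleftrightarrow> w = w' \<and> x \<in> a" for w w' x a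
    by (auto simp: tag_def g_inj)
  define pr where "pr = (\<lambda>a b. tag u a \<union> tag v b)"
  have pr_inj: "a = a' \<and> b = b'" if "pr a b = pr a' b'" for a b a' b'
  proof -
    have "g (w, x) \<in> pr a b \<longleftrightarrow> g (w, x) \<in> pr a' b'" for w x
      using that by simp
    then have *: "(w = u \<and> x \<in> a \<or> w = v \<and> x \<in> b) = (w = u \<and> x \<in> a' \<or> w = v \<and> x \<in> b')" for w x
      by (simp add: pr_def tag_mem)
    show ?thesis
      using *[of u] *[of v] uv by auto
  qed
  then have pr_iff: "pr a b = pr a' b' \<longleftrightarrow> a = a' \<and> b = b'" for a b a' b'
    by blast
  define pick where "pick = (\<lambda>A. SOME f :: 'a \<Rightarrow> 'a set. A = range f)"
  define cl where "cl = (\<lambda>A. if A = {} then pr {} {} else pr UNIV {g (x, y) | x y. y \<in> pick A x})"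
  have pick: "A = range (pick A)" if smA: "sm A" "A \<noteq> {}" for A
  proof -
    obtain f :: "'a \<Rightarrow> 'a set" where f: "A \<subseteq> range f" using smA by (auto simp: sm_def)
    obtain c where c: "c \<in> A" using smA by blast
    have "A = range (\<lambda>x. if f x \<in> A then f x else c)"
      using f c by auto
    then show ?thesis unfolding pick_def by (rule someI[where P = "\<lambda>f. A = range f"])
  qed
  have cl_inj: "inj_on cl {A. sm A}"
  proof (rule inj_onI)
    fix A B assume "A \<in> {A. sm A}" "B \<in> {A. sm A}" and eq: "cl A = cl B"
    then have sm: "sm A" "sm B" by auto
    have "pr {} c \<noteq> pr UNIV d" "pr UNIV d \<noteq> pr {} c" for c d
      by (simp_all add: pr_iff)
    then have "A = {} \<longleftrightarrow> B = {}"
      using eq unfolding cl_def by metis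
    then consider "A = {}" "B = {}" | "A \<noteq> {}" "B \<noteq> {}"
      by blast
    then show "A = B"
    proof cases
      case 2
      then have "{g (x, y) | x y. y \<in> pick A x} = {g (x, y) | x y. y \<in> pick B x}"
        using eq by (simp add: cl_def pr_iff)
      then have "g (x, y) \<in> {g (x, y) | x y. y \<in> pick A x} \<longleftrightarrow>
                 g (x, y) \<in> {g (x, y) | x y. y \<in> pick B x}" for x y
        by simp
      then have "y \<in> pick A x \<longleftrightarrow> y \<in> pick B x" for x y
        by (simp add: g_inj)
      then have "pick A = pick B" by (intro ext set_eqI)
      then show ?thesis
        using pick[OF sm(1) 2(1)] pick[OF sm(2) 2(2)] by simp
    qed simp
  qed
  have sm_Un: "sm (A \<union> B)" if smAB: "sm A" "sm B" for A B
  proof -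
    obtain f h :: "'a \<Rightarrow> 'a set" where fh: "A \<subseteq> range f" "B \<subseteq> range h"
      using smAB by (auto simp: sm_def)
    define e where "e = (\<lambda>z. case inv g z of (w, x) \<Rightarrow> if w = u then f x else h x)"
    have "e (g (u, x)) = f x" "e (g (v, x)) = h x" for x
      using g uv by (simp_all add: e_def bij_is_inj)
    then have "f x \<in> range e" "h x \<in> range e" for x
      using rangeI[of e "g (u, x)"] rangeI[of e "g (v, x)"] by simp_all
    then have "range f \<union> range h \<subseteq> range e" by (intro Un_least image_subsetI)
    then have "A \<union> B \<subseteq> range e"
      by (rule subset_trans[OF Un_mono[OF fh]])
    then show ?thesis unfolding sm_def by (intro exI[of _ e])
  qed
  have sm_pr: "sm {pr a b | a b. a \<in> A \<and> b \<in> B}" if smAB: "sm A" "sm B" for A B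
  proof -
    obtain f h :: "'a \<Rightarrow> 'a set" where fh: "A \<subseteq> range f" "B \<subseteq> range h"
      using smAB by (auto simp: sm_def)
    define e where "e = (\<lambda>z. case inv g z of (x, y) \<Rightarrow> pr (f x) (h y))"
    have e: "e (g (x, y)) = pr (f x) (h y)" for x y
      using g by (auto simp: e_def bij_is_inj)
    have "{pr a b | a b. a \<in> A \<and> b \<in> B} \<subseteq> range e"
    proof
      fix t assume "t \<in> {pr a b | a b. a \<in> A \<and> b \<in> B}"
      then obtain x y where "t = pr (f x) (h y)" using fh by blast
      then show "t \<in> range e" using rangeI[of e "g (x, y)"] by (simp add: e)
    qed
    then show ?thesis unfolding sm_def by (intro exI[of _ e])
  qed
  define U where "U = \<lparr>small = sm, pt = {}, pair = pr, inl = pr {}, inr = pr UNIV, cls = cl\<rparr>"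
  have "sm (f ` A)" if smA: "sm A" for A f
  proof -
    obtain h :: "'a \<Rightarrow> 'a set" where "A \<subseteq> range h" using smA by (auto simp: sm_def)
    then have "f ` A \<subseteq> range (f \<circ> h)" by auto
    then show ?thesis unfolding sm_def by (intro exI[of _ "f \<circ> h"])
  qed
  moreover have "sm B" if "sm A" "B \<subseteq> A" for A B
    using that unfolding sm_def by (elim exE) (intro exI, rule subset_trans)
  moreover have "sm {{}}" unfolding sm_def by (rule exI[of _ "\<lambda>_. {}"]) auto
  moreover have "inj (pr a)" for a
    by (rule injI) (simp add: pr_iff)
  moreover have "range (pr {}) \<inter> range (pr UNIV) = {}"
    by (auto simp: pr_iff)
  ultimately have "set_universe U"
    unfolding set_universe_def one_def prod_ob_def U_def set_univ.simps
    by (intro conjI allI impI; (elim conjE)?) (simp_all add: sm_Un sm_pr cl_inj pr_iff)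
  then show ?thesis by (intro exI[of _ U]) (auto simp: U_def sm_def)
qed

section \<open>Functors and coalgebras\<close>

text \<open>
  The values \<open>H A\<close> are sets over an arbitrary type \<open>'h\<close>. Endofunctors are the case
  \<open>'h = 'u\<close> with small values; the separate type also admits functors such as the power set functor
  over universes that are not closed under power sets. \<open>fmap H A B f\<close> is \<open>H f\<close> for \<open>f\<close> from \<open>A\<close>
  to \<open>B\<close>.
\<close>

record ('u, 'h) set_func =
  fob :: "'u set \<Rightarrow> 'h set"
  fmap :: "'u set \<Rightarrow> 'u set \<Rightarrow> ('u \<Rightarrow> 'u) \<Rightarrow> 'h \<Rightarrow> 'h"

definition set_functor :: "'u set_univ \<Rightarrow> ('u, 'h) set_func \<Rightarrow> bool" where
  "set_functor U H \<longleftrightarrow>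
     (\<forall>A B f. small U A \<and> small U B \<and> f \<in> A \<rightarrow>\<^sub>E B \<longrightarrow>
        fmap H A B f \<in> fob H A \<rightarrow>\<^sub>E fob H B) \<and>
     (\<forall>A. small U A \<longrightarrow> fmap H A A (\<lambda>x\<in>A. x) = (\<lambda>t\<in>fob H A. t)) \<and>
     (\<forall>A B C f g. small U A \<and> small U B \<and> small U C \<and> f \<in> A \<rightarrow>\<^sub>E B \<and> g \<in> B \<rightarrow>\<^sub>E C \<longrightarrow>
        fmap H A C (compose A g f) = compose (fob H A) (fmap H B C g) (fmap H A B f))"

definition zippable :: "'u set_univ \<Rightarrow> ('u, 'h) set_func \<Rightarrow> bool" where
  "zippable U H \<longleftrightarrow> (\<forall>A B. small U A \<and> small U B \<longrightarrow>
     inj_on (\<lambda>t.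
       (fmap H (sum_ob U A B) (sum_ob U A (one U)) (sum_map U A B (\<lambda>a\<in>A. a) (bang U B)) t,
        fmap H (sum_ob U A B) (sum_ob U (one U) B) (sum_map U A B (bang U A) (\<lambda>b\<in>B. b)) t))
      (fob H (sum_ob U A B)))"

definition coalgebra ::
  "'u set_univ \<Rightarrow> ('u, 'h) set_func \<Rightarrow> 'u set \<Rightarrow> ('u \<Rightarrow> 'h) \<Rightarrow> bool" where
  "coalgebra U H X \<xi> \<longleftrightarrow> small U X \<and> \<xi> \<in> X \<rightarrow>\<^sub>E fob H X"

section \<open>Select routines\<close>

text \<open>
  \<open>sel X Y Z y z = (K, k)\<close> means that the routine returns the map \<open>k\<close> from \<open>Y\<close> to \<open>K\<close> on the
  chain \<open>y\<close> from \<open>X\<close> onto \<open>Y\<close>, \<open>z\<close> from \<open>Y\<close> onto \<open>Z\<close>.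
\<close>

type_synonym 'u selector =
  "'u set \<Rightarrow> 'u set \<Rightarrow> 'u set \<Rightarrow> ('u \<Rightarrow> 'u) \<Rightarrow> ('u \<Rightarrow> 'u) \<Rightarrow> 'u set \<times> ('u \<Rightarrow> 'u)"

definition surj_chain ::
  "'u set_univ \<Rightarrow> 'u set \<Rightarrow> 'u set \<Rightarrow> 'u set \<Rightarrow> ('u \<Rightarrow> 'u) \<Rightarrow> ('u \<Rightarrow> 'u) \<Rightarrow> bool" where
  "surj_chain U X Y Z y z \<longleftrightarrow>
     small U X \<and> small U Y \<and> small U Z \<and> surjection X Y y \<and> surjection Y Z z"

definition select_routine :: "'u set_univ \<Rightarrow> 'u selector \<Rightarrow> bool" where
  "select_routine U sel \<longleftrightarrow> (\<forall>X Y Z y z K k.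
     surj_chain U X Y Z y z \<and> sel X Y Z y z = (K, k) \<longrightarrow> small U K \<and> k \<in> Y \<rightarrow>\<^sub>E K)"

definition respects_compound_blocks :: "'u set_univ \<Rightarrow> 'u selector \<Rightarrow> bool" where
  "respects_compound_blocks U sel \<longleftrightarrow> (\<forall>X Y Z y z K k.
     surj_chain U X Y Z y z \<and> sel X Y Z y z = (K, k) \<longrightarrow> equiv Y (kernel Y z \<union> kernel Y k))"

section \<open>The partition refinement algorithm\<close>

text \<open>
  In the state after \<open>i\<close> iterations, \<open>qbar\<close> is the map \<open>\<langle>q\<^sub>0, \<dots>, q\<^sub>i\<rangle>\<close> from \<open>X\<close> to the
  (left-nested) product \<open>Kbar = K\<^sub>0 \<times> \<dots> \<times> K\<^sub>i\<close>.
\<close>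

record 'u pr_state =
  Kbar :: "'u set"
  qbar :: "'u \<Rightarrow> 'u"
  Qrel :: "('u \<times> 'u) set"
  Prel :: "('u \<times> 'u) set"

definition conn_map ::
  "'u set_univ \<Rightarrow> 'u set \<Rightarrow> ('u \<times> 'u) set \<Rightarrow> ('u \<times> 'u) set \<Rightarrow> 'u \<Rightarrow> 'u" where
  "conn_map U X P Q =
     (THE f. f \<in> quot U X P \<rightarrow>\<^sub>E quot U X Q \<and> compose X f (kappa U X P) = kappa U X Q)"

definition sel_result ::
  "'u set_univ \<Rightarrow> 'u selector \<Rightarrow> 'u set \<Rightarrow> 'u pr_state \<Rightarrow> 'u set \<times> ('u \<Rightarrow> 'u)" where
  "sel_result U sel X s =
     sel X (quot U X (Prel s)) (quot U X (Qrel s))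
       (kappa U X (Prel s)) (conn_map U X (Prel s) (Qrel s))"

definition next_K :: "'u set_univ \<Rightarrow> 'u selector \<Rightarrow> 'u set \<Rightarrow> 'u pr_state \<Rightarrow> 'u set" where
  "next_K U sel X s = fst (sel_result U sel X s)"

definition next_q :: "'u set_univ \<Rightarrow> 'u selector \<Rightarrow> 'u set \<Rightarrow> 'u pr_state \<Rightarrow> 'u \<Rightarrow> 'u" where
  "next_q U sel X s = compose X (snd (sel_result U sel X s)) (kappa U X (Prel s))"

definition init_state ::
  "'u set_univ \<Rightarrow> ('u, 'h) set_func \<Rightarrow> 'u set \<Rightarrow> ('u \<Rightarrow> 'h) \<Rightarrow> 'u pr_state" where
  "init_state U H X \<xi> =
     \<lparr>Kbar = one U, qbar = bang U X, Qrel = X \<times> X,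
      Prel = kernel X (compose X (fmap H X (one U) (bang U X)) \<xi>)\<rparr>"

definition step ::
  "'u set_univ \<Rightarrow> ('u, 'h) set_func \<Rightarrow> 'u selector \<Rightarrow> 'u set \<Rightarrow> ('u \<Rightarrow> 'h) \<Rightarrow>
   'u pr_state \<Rightarrow> 'u pr_state" where
  "step U H sel X \<xi> s =
     (let K' = prod_ob U (Kbar s) (next_K U sel X s);
          q' = pairing U X (qbar s) (next_q U sel X s)
      in \<lparr>Kbar = K', qbar = q', Qrel = kernel X q',
          Prel = kernel X (compose X (fmap H X K' q') \<xi>)\<rparr>)"

primrec run ::
  "'u set_univ \<Rightarrow> ('u, 'h) set_func \<Rightarrow> 'u selector \<Rightarrow> 'u set \<Rightarrow> ('u \<Rightarrow> 'h) \<Rightarrow>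
   nat \<Rightarrow> 'u pr_state" where
  "run U H sel X \<xi> 0 = init_state U H X \<xi>"
| "run U H sel X \<xi> (Suc i) = step U H sel X \<xi> (run U H sel X \<xi> i)"

text \<open>
  \<open>run\<close> iterates the loop body unconditionally; \<open>executes \<dots> i\<close> says that the while loop actually
  reaches the \<open>i\<close>-th execution of its body, the one that computes the data of index \<open>i + 1\<close>.
\<close>

definition executes ::
  "'u set_univ \<Rightarrow> ('u, 'h) set_func \<Rightarrow> 'u selector \<Rightarrow> 'u set \<Rightarrow> ('u \<Rightarrow> 'h) \<Rightarrow> nat \<Rightarrow> bool" where
  "executes U H sel X \<xi> i \<longleftrightarrow>
     (\<forall>j\<le>i. Prel (run U H sel X \<xi> j) \<subset> Qrel (run U H sel X \<xi> j))"

end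

theory Submission
  imports Defs
begin

text \<open>
  If the union of the kernels of \<open>f : X \<rightarrow> A\<close> and \<open>g : X \<rightarrow> B\<close> is an equivalence, then every class of
  the union is a single class of \<open>f\<close> or a single class of \<open>g\<close>. So \<open>X\<close> splits into a part \<open>S\<close> on which
  \<open>f\<close> is finer and its complement, on which \<open>g\<close> is finer, and both parts are closed under both kernels.
  The pairing of \<open>f\<close> and \<open>g\<close> then factors through the map \<open>h : X \<rightarrow> f[S] + g[X - S]\<close> that is \<open>f\<close> on \<open>S\<close>
  and \<open>g\<close> elsewhere. Collapsing the right summand turns \<open>h\<close> into a map that factors through \<open>f\<close>,
  collapsing the left summand into one that factors through \<open>g\<close>, so zippability yields the
  kernel of \<open>H\<close> applied to the pairing. In the algorithm, \<open>f\<close> and \<open>g\<close> are the maps \<open>qbar\<close> and \<open>q\<close>,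
  whose kernels are the preimages under \<open>kappa\<close> of the kernels of the connecting map and
  of the selected map.
\<close>

section \<open>Products, coproducts and their maps inside the universe\<close>

lemma PiE_imp_Pi: "f \<in> X \<rightarrow>\<^sub>E A \<Longrightarrow> f \<in> X \<rightarrow> A"
  by (simp add: PiE_def)

lemma set_universeD:
  assumes "set_universe U"
  shows small_one: "small U (one U)"
    and small_subset: "\<And>A B. small U A \<Longrightarrow> B \<subseteq> A \<Longrightarrow> small U B"
    and small_image: "\<And>A f. small U A \<Longrightarrow> small U (f ` A)"
    and small_prod_ob: "\<And>A B. small U A \<Longrightarrow> small U B \<Longrightarrow> small U (prod_ob U A B)"
    and small_sum_ob: "\<And>A B. small U A \<Longrightarrow> small U B \<Longrightarrow> small U (sum_ob U A B)"
    and pair_eq_iff: "\<And>a b a' b'. pair U a b = pair U a' b' \<longleftrightarrow> a = a' \<and> b = b'"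
    and inl_eq_iff: "\<And>a a'. inl U a = inl U a' \<longleftrightarrow> a = a'"
    and inr_eq_iff: "\<And>a a'. inr U a = inr U a' \<longleftrightarrow> a = a'"
    and inl_neq_inr: "\<And>a b. inl U a \<noteq> inr U b"
    and inj_on_cls: "inj_on (cls U) {A. small U A}"
proof -
  note U = assms[unfolded set_universe_def]
  show "small U (one U)" "inj_on (cls U) {A. small U A}"
    using U by simp_all
  show "small U B" if "small U A" "B \<subseteq> A" for A B
    using U that by (elim conjE) metis
  show im: "small U (f ` A)" if "small U A" for A f
    using U that by (elim conjE) metis
  show "small U (prod_ob U A B)" if "small U A" "small U B" for A B
    using U that by (elim conjE) metis
  show "small U (sum_ob U A B)" if "small U A" "small U B" for A B
    unfolding sum_ob_def using U im[OF that(1)] im[OF that(2)] by (elim conjE) metis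
  show "pair U a b = pair U a' b' \<longleftrightarrow> a = a' \<and> b = b'" for a b a' b'
    using U by (elim conjE) metis
  have inj: "inj (inl U)" "inj (inr U)" and disj: "range (inl U) \<inter> range (inr U) = {}"
    using U by blast+
  show "inl U a = inl U a' \<longleftrightarrow> a = a'" "inr U a = inr U a' \<longleftrightarrow> a = a'" for a a'
    using inj by (simp_all only: inj_eq)
  show "inl U a \<noteq> inr U b" for a b
    using disj by (metis IntI emptyE rangeI)
qed

lemma sum_map_inl:
  assumes "set_universe U" "a \<in> A"
  shows "sum_map U A B f g (inl U a) = inl U (f a)"
proof -
  have "inj_on (inl U) A"
    using inl_eq_iff[OF assms(1)] by (simp add: inj_on_def)
  then show ?thesis
    using assms(2) by (simp add: sum_map_def sum_ob_def)
qed

lemma sum_map_inr: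
  assumes "set_universe U" "b \<in> B"
  shows "sum_map U A B f g (inr U b) = inr U (g b)"
proof -
  have "inj_on (inr U) B"
    using inr_eq_iff[OF assms(1)] by (simp add: inj_on_def)
  moreover have "inr U b \<notin> inl U ` A"
    using inl_neq_inr[OF assms(1)] by (metis imageE)
  ultimately show ?thesis
    using assms(2) by (simp add: sum_map_def sum_ob_def)
qed

lemma sum_map_funcset:
  assumes U: "set_universe U" and f: "f \<in> A \<rightarrow> A'" and g: "g \<in> B \<rightarrow> B'"
  shows "sum_map U A B f g \<in> sum_ob U A B \<rightarrow>\<^sub>E sum_ob U A' B'"
proof (rule PiE_I)
  fix t assume "t \<in> sum_ob U A B"
  then consider a where "a \<in> A" "t = inl U a" | b where "b \<in> B" "t = inr U b"
    unfolding sum_ob_def by blast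
  then show "sum_map U A B f g t \<in> sum_ob U A' B'"
    using f g by cases (auto simp: sum_map_inl[OF U] sum_map_inr[OF U] sum_ob_def)
qed (simp add: sum_map_def)

lemma pairing_funcset:
  assumes "f \<in> X \<rightarrow> A" "g \<in> X \<rightarrow> B"
  shows "pairing U X f g \<in> X \<rightarrow>\<^sub>E prod_ob U A B"
  using assms by (auto simp: pairing_def prod_ob_def)

section \<open>The functor applied to factorizations and pairings\<close>

lemma fmap_comp:
  assumes "set_functor U H" "small U X" "small U A" "small U B"
    and "f \<in> X \<rightarrow>\<^sub>E A" "m \<in> A \<rightarrow>\<^sub>E B" "t \<in> fob H X"
  shows "fmap H X B (compose X m f) t = fmap H A B m (fmap H X A f t)"
proof -
  have "fmap H X B (compose X m f) = compose (fob H X) (fmap H A B m) (fmap H X A f)"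
    using assms(1-6) unfolding set_functor_def by blast
  then show ?thesis
    using assms(7) by (simp add: compose_def)
qed

lemma fmap_funcset:
  assumes "set_functor U H" "small U A" "small U B" "f \<in> A \<rightarrow>\<^sub>E B"
  shows "fmap H A B f \<in> fob H A \<rightarrow>\<^sub>E fob H B"
  using assms unfolding set_functor_def by blast

text \<open>By functoriality \<open>H h\<close> factors through \<open>H f\<close>. The mediating
  map \<open>m\<close> is cut down to \<open>A\<close> inside the proof, so a witness may be given
  as a plain function.\<close>

lemma fmap_eq_of_factor:
  assumes "set_functor U H" "small U X" "small U A" "small U B"
    and "f \<in> X \<rightarrow>\<^sub>E A" "h \<in> X \<rightarrow>\<^sub>E B" "m \<in> A \<rightarrow> B"
    and factor: "\<And>x. x \<in> X \<Longrightarrow> h x = m (f x)"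
    and "s \<in> fob H X" "t \<in> fob H X" "fmap H X A f s = fmap H X A f t"
  shows "fmap H X B h s = fmap H X B h t"
proof -
  have "h = compose X (restrict m A) f"
    using assms(5,6) factor
    by (intro extensionalityI[of _ X]) (auto simp: compose_def PiE_iff)
  moreover have "restrict m A \<in> A \<rightarrow>\<^sub>E B"
    using assms(7) by simp
  ultimately show ?thesis
    using fmap_comp assms by metis
qed

text \<open>Stated for single elements, so that \<open>s\<close> and \<open>t\<close> can later be
  values of the coalgebra. From left to right, \<open>f\<close> and \<open>g\<close> factor through
  the pairing; zippability and the equivalence serve the converse.\<close>

lemma fmap_pairing_eq_iff:
  assumes U: "set_universe U" and H: "set_functor U H" and zip: "zippable U H"
    and sm: "small U X" "small U A" "small U B"
    and f: "f \<in> X \<rightarrow>\<^sub>E A" and g: "g \<in> X \<rightarrow>\<^sub>E B"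
    and eqv: "equiv X (kernel X f \<union> kernel X g)"
    and st: "s \<in> fob H X" "t \<in> fob H X"
  shows "fmap H X (prod_ob U A B) (pairing U X f g) s = fmap H X (prod_ob U A B) (pairing U X f g) t
    \<longleftrightarrow> fmap H X A f s = fmap H X A f t \<and> fmap H X B g s = fmap H X B g t"
    (is "?fg s = ?fg t \<longleftrightarrow> _")
proof (intro iffI conjI; (elim conjE)?)
  have pm: "pairing U X f g \<in> X \<rightarrow>\<^sub>E prod_ob U A B"
    using f g by (intro pairing_funcset) auto
  note smP = small_prod_ob[OF U sm(2,3)]
  {
    assume eq: "?fg s = ?fg t"
    \<comment> \<open>The witnesses \<open>m\<close> are the two projections, well defined because
      \<open>pair U\<close> is injective.\<close>
    show "fmap H X A f s = fmap H X A f t"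
      by (rule fmap_eq_of_factor[OF H sm(1) smP sm(2) pm f _ _ st eq,
            where m = "\<lambda>p. THE a. \<exists>b. p = pair U a b"])
        (auto simp: prod_ob_def pairing_def pair_eq_iff[OF U])
    show "fmap H X B g s = fmap H X B g t"
      by (rule fmap_eq_of_factor[OF H sm(1) smP sm(3) pm g _ _ st eq,
            where m = "\<lambda>p. THE b. \<exists>a. p = pair U a b"])
        (auto simp: prod_ob_def pairing_def pair_eq_iff[OF U])
  }
  assume eqf: "fmap H X A f s = fmap H X A f t" and eqg: "fmap H X B g s = fmap H X B g t"
  \<comment> \<open>\<open>S\<close> collects the points whose \<open>f\<close>-class lies inside
    their \<open>g\<close>-class; a point whose two classes coincide also goes to
    \<open>S\<close>.\<close>
  define S where "S = {x \<in> X. \<forall>y\<in>X. f x = f y \<longrightarrow> g x = g y}"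
  have SX: "S \<subseteq> X" by (auto simp: S_def)
  have union_trans: "f x = f z \<or> g x = g z"
    if "x \<in> X" "y \<in> X" "z \<in> X" "f x = f y \<or> g x = g y" "f y = f z \<or> g y = g z" for x y z
    using that equivE[OF eqv] unfolding trans_def kernel_def by blast
  \<comment> \<open>Some \<open>z\<close> shows that \<open>x\<close> is outside \<open>S\<close>.
    Transitivity through \<open>x\<close> relates \<open>y\<close> to \<open>z\<close>; this cannot
    be by \<open>g\<close>, since \<open>g y = g x\<close> and \<open>g x \<noteq> g z\<close>, so
    \<open>f y = f z = f x\<close>.\<close>
  have finer_g: "f x = f y" if x: "x \<in> X - S" and "y \<in> X" "g x = g y" for x y
  proof -
    obtain z where "z \<in> X" "f x = f z" "g x \<noteq> g z"
      using x by (auto simp: S_def)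
    then show ?thesis
      using union_trans[of y x z] that by auto
  qed
  have finer_f: "g x = g y" if "x \<in> S" "y \<in> X" "f x = f y" for x y
    using that by (auto simp: S_def)
  have closed_f: "y \<in> S" if "x \<in> S" "y \<in> X" "f x = f y" for x y
    using that unfolding S_def mem_Collect_eq by metis
  \<comment> \<open>If \<open>y\<close> were outside \<open>S\<close>, \<open>finer_g\<close> would
    give \<open>f y = f x\<close>, and then \<open>closed_f\<close> would put \<open>y\<close> into
    \<open>S\<close>.\<close>
  have closed_g: "y \<in> S" if "x \<in> S" "y \<in> X" "g x = g y" for x y
    using that SX finer_g[of y x] closed_f[of x y] by (metis DiffI subsetD)
  define A' where "A' = f ` S"
  define B' where "B' = g ` (X - S)"
  \<comment> \<open>Since both parts are closed, the value \<open>f x\<close> alone, or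
    \<open>g x\<close> alone, decides whether \<open>x\<close> is in \<open>S\<close>. The case
    distinctions in the witnesses \<open>m\<close> below rest on this.\<close>
  have fA': "f x \<in> A' \<longleftrightarrow> x \<in> S" if "x \<in> X" for x
    using that closed_f by (auto simp: A'_def)
  have gB': "g x \<in> B' \<longleftrightarrow> x \<notin> S" if "x \<in> X" for x
    using that closed_g by (auto simp: B'_def)
  have smAB': "small U A'" "small U B'"
    using small_image[OF U] small_subset[OF U sm(1)] SX by (auto simp: A'_def B'_def)
  note sm_one = small_one[OF U]
  define h where "h = (\<lambda>x\<in>X. if x \<in> S then inl U (f x) else inr U (g x))"
  \<comment> \<open>\<open>c1\<close> and \<open>c2\<close> are the two maps in the definition of
    \<open>zippable\<close>, taken at \<open>A'\<close> and \<open>B'\<close>.\<close>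
  define c1 where "c1 = sum_map U A' B' (\<lambda>a\<in>A'. a) (bang U B')"
  define c2 where "c2 = sum_map U A' B' (bang U A') (\<lambda>b\<in>B'. b)"
  have h: "h \<in> X \<rightarrow>\<^sub>E sum_ob U A' B'"
    by (auto simp: h_def sum_ob_def A'_def B'_def)
  have c1: "c1 \<in> sum_ob U A' B' \<rightarrow>\<^sub>E sum_ob U A' (one U)"
    unfolding c1_def by (rule sum_map_funcset[OF U]) (auto simp: bang_def one_def)
  have c2: "c2 \<in> sum_ob U A' B' \<rightarrow>\<^sub>E sum_ob U (one U) B'"
    unfolding c2_def by (rule sum_map_funcset[OF U]) (auto simp: bang_def one_def)
  have c1h: "compose X c1 h \<in> X \<rightarrow>\<^sub>E sum_ob U A' (one U)"
    and c2h: "compose X c2 h \<in> X \<rightarrow>\<^sub>E sum_ob U (one U) B'"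
    using h c1 c2 by (auto simp: compose_def)
  \<comment> \<open>After \<open>c1\<close>, the map \<open>h\<close> is \<open>inl U\<close> of
    \<open>f\<close> on \<open>S\<close> and constant elsewhere, so it depends on \<open>f x\<close>
    only; dually for \<open>c2\<close> and \<open>g\<close>.\<close>
  have "fmap H X (sum_ob U A' (one U)) (compose X c1 h) s =
        fmap H X (sum_ob U A' (one U)) (compose X c1 h) t"
    by (rule fmap_eq_of_factor[OF H sm(1,2) small_sum_ob[OF U smAB'(1) sm_one] f c1h _ _ st eqf,
          where m = "\<lambda>a. if a \<in> A' then inl U a else inr U (pt U)"])
      (auto simp: sum_ob_def one_def compose_def h_def c1_def bang_def fA' gB'
         sum_map_inl[OF U] sum_map_inr[OF U])
  moreover have "fmap H X (sum_ob U (one U) B') (compose X c2 h) s =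
        fmap H X (sum_ob U (one U) B') (compose X c2 h) t"
    by (rule fmap_eq_of_factor[OF H sm(1,3) small_sum_ob[OF U sm_one smAB'(2)] g c2h _ _ st eqg,
          where m = "\<lambda>b. if b \<in> B' then inr U b else inl U (pt U)"])
      (auto simp: sum_ob_def one_def compose_def h_def c2_def bang_def fA' gB'
         sum_map_inl[OF U] sum_map_inr[OF U])
  moreover have "fmap H X (sum_ob U A' B') h ` {s, t} \<subseteq> fob H (sum_ob U A' B')"
    using fmap_funcset[OF H sm(1) small_sum_ob[OF U smAB'] h] st by auto
  ultimately have eqh: "fmap H X (sum_ob U A' B') h s = fmap H X (sum_ob U A' B') h t"
    using zip[unfolded zippable_def, rule_format, OF conjI, OF smAB'] st
    by (simp add: inj_on_def c1_def[symmetric] c2_def[symmetric]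
        fmap_comp[OF H sm(1) small_sum_ob[OF U smAB'] small_sum_ob[OF U smAB'(1) sm_one] h c1]
        fmap_comp[OF H sm(1) small_sum_ob[OF U smAB'] small_sum_ob[OF U sm_one smAB'(2)] h c2])
  \<comment> \<open>Points identified by \<open>h\<close> lie in the same part, where agreement
    under the finer map forces agreement under the other.\<close>
  have ker_h: "pairing U X f g x = pairing U X f g y" if "x \<in> X" "y \<in> X" "h x = h y" for x y
  proof -
    have "x \<in> S \<and> y \<in> S \<and> f x = f y \<or> x \<notin> S \<and> y \<notin> S \<and> g x = g y"
      using that inl_neq_inr[OF U] inl_neq_inr[OF U, symmetric]
      by (auto simp: h_def inl_eq_iff[OF U] inr_eq_iff[OF U] split: if_splits)
    then have "f x = f y \<and> g x = g y"
      using that finer_g[of x y] finer_f[of x y] by blast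
    then show ?thesis
      using that by (simp add: pairing_def)
  qed
  \<comment> \<open>Taking images as \<open>A'\<close> and \<open>B'\<close> makes \<open>h\<close>
    onto the sum, so \<open>inv_into X h\<close> is a section of \<open>h\<close>, and the pairing
    factors through \<open>h\<close> along it.\<close>
  have onto_h: "sum_ob U A' B' \<subseteq> h ` X"
    using SX by (auto simp: sum_ob_def A'_def B'_def h_def image_iff)
  show "?fg s = ?fg t"
  proof (rule fmap_eq_of_factor[OF H sm(1) small_sum_ob[OF U smAB'] smP h pm _ _ st eqh])
    show "(\<lambda>y. pairing U X f g (inv_into X h y)) \<in> sum_ob U A' B' \<rightarrow> prod_ob U A B"
      using onto_h pm by (auto intro!: PiE_mem[OF pm] inv_into_into)
    show "pairing U X f g x = pairing U X f g (inv_into X h (h x))" if "x \<in> X" for x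
      using that by (intro ker_h) (auto simp: inv_into_into f_inv_into_f)
  qed
qed

section \<open>Kernels, quotients of small sets and the connecting map\<close>

lemma equiv_kernel: "equiv X (kernel X f)"
  by (auto simp: equiv_def refl_on_def sym_def trans_def kernel_def)

lemma kappa_eq_iff:
  assumes U: "set_universe U" and X: "small U X" and R: "equiv X R" and xy: "x \<in> X" "y \<in> X"
  shows "kappa U X R x = kappa U X R y \<longleftrightarrow> (x, y) \<in> R"
proof -
  \<comment> \<open>Classes are subsets of \<open>X\<close>, hence small, and \<open>cls U\<close>
    is injective on small sets.\<close>
  have "small U (R `` {z})" for z
    using R by (intro small_subset[OF U X]) (auto simp: equiv_def)
  then have "cls U (R `` {x}) = cls U (R `` {y}) \<longleftrightarrow> R `` {x} = R `` {y}"
    using inj_on_cls[OF U] by (auto simp: inj_on_def)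
  then show ?thesis
    using xy eq_equiv_class_iff[OF R] by (simp add: kappa_def)
qed

lemma kappa_surjection: "surjection X (quot U X R) (kappa U X R)"
  by (auto simp: surjection_def quot_def kappa_def quotient_def)

lemma small_quot:
  assumes "set_universe U" "small U X"
  shows "small U (quot U X R)"
  using small_image[OF assms] kappa_surjection[of X U R] unfolding surjection_def by metis

text \<open>Choosing representatives of \<open>P\<close>-classes gives such a map:
  \<open>P \<subseteq> Q\<close> makes its value independent of the choice, and surjectivity of
  \<open>kappa U X P\<close> makes it unique, which resolves the \<open>THE\<close> in
  \<open>conn_map\<close>.\<close>

lemma conn_map:
  assumes U: "set_universe U" and X: "small U X" and P: "equiv X P" and Q: "equiv X Q"
    and PQ: "P \<subseteq> Q"
  shows "surjection (quot U X P) (quot U X Q) (conn_map U X P Q)"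
    and "\<And>x. x \<in> X \<Longrightarrow> conn_map U X P Q (kappa U X P x) = kappa U X Q x"
proof -
  let ?p = "kappa U X P" and ?q = "kappa U X Q"
  have p: "?p ` X = quot U X P" and q: "?q ` X = quot U X Q"
    using kappa_surjection[of X U] by (auto simp: surjection_def)
  define f where "f = (\<lambda>y\<in>quot U X P. ?q (inv_into X ?p y))"
  have fp: "f (?p x) = ?q x" if x: "x \<in> X" for x
  proof -
    have "inv_into X ?p (?p x) \<in> X" "?p (inv_into X ?p (?p x)) = ?p x"
      using x by (auto simp: inv_into_into f_inv_into_f)
    then have "?q (inv_into X ?p (?p x)) = ?q x"
      using x PQ by (auto simp: kappa_eq_iff[OF U X P] kappa_eq_iff[OF U X Q])
    then show ?thesis
      using x p by (auto simp: f_def)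
  qed
  have "conn_map U X P Q = f"
    unfolding conn_map_def
  proof (rule the_equality)
    show "f \<in> quot U X P \<rightarrow>\<^sub>E quot U X Q \<and> compose X f ?p = ?q"
    proof
      show "f \<in> quot U X P \<rightarrow>\<^sub>E quot U X Q"
        using p q by (auto simp: f_def intro!: inv_into_into)
      show "compose X f ?p = ?q"
        by (rule extensionalityI[of _ X]) (simp_all add: compose_eq fp, simp add: kappa_def)
    qed
    fix f' assume f': "f' \<in> quot U X P \<rightarrow>\<^sub>E quot U X Q \<and> compose X f' ?p = ?q"
    show "f' = f"
    proof (rule extensionalityI[of _ "quot U X P"])
      fix y assume "y \<in> quot U X P"
      then obtain x where x: "x \<in> X" "y = ?p x" using p by blast
      then show "f' y = f y"
        using f' fp[OF x(1)] by (metis compose_eq)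
    qed (use f' in \<open>auto simp: f_def PiE_iff\<close>)
  qed
  then show conn: "conn_map U X P Q (?p x) = ?q x" if "x \<in> X" for x
    using fp that by simp
  have "f ` quot U X P = quot U X Q"
    unfolding p[symmetric] q[symmetric] image_image using fp by simp
  then show "surjection (quot U X P) (quot U X Q) (conn_map U X P Q)"
    using \<open>conn_map U X P Q = f\<close> by (auto simp: surjection_def f_def)
qed

section \<open>Selected maps and invariants of the run\<close>

lemma equiv_preimage:
  assumes "equiv Y R" "p \<in> X \<rightarrow> Y"
  shows "equiv X {(x, y). x \<in> X \<and> y \<in> X \<and> (p x, p y) \<in> R}"
  using assms unfolding equiv_def refl_on_def sym_def trans_def by blast

text \<open>The inclusion \<open>PQ\<close> yields the chain of surjections to which the assumptions
  on \<open>sel\<close> apply. Pulling back along \<open>kappa\<close> turns the kernel of the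
  connecting map into \<open>Qrel s\<close> and that of the selected map into the kernel of
  \<open>next_q\<close>.\<close>

lemma next_q:
  assumes U: "set_universe U" and X: "small U X" and sel: "select_routine U sel"
    and P: "equiv X (Prel s)" and Q: "equiv X (Qrel s)" and PQ: "Prel s \<subseteq> Qrel s"
  shows small_next_K: "small U (next_K U sel X s)"
    and next_q_funcset: "next_q U sel X s \<in> X \<rightarrow>\<^sub>E next_K U sel X s"
    and equiv_Un_kernel_next_q: "respects_compound_blocks U sel \<Longrightarrow>
      equiv X (Qrel s \<union> kernel X (next_q U sel X s))"
proof -
  let ?Y = "quot U X (Prel s)" and ?p = "kappa U X (Prel s)"
    and ?z = "conn_map U X (Prel s) (Qrel s)"
  obtain K k where Kk: "sel_result U sel X s = (K, k)" by fastforce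
  have chain: "surj_chain U X ?Y (quot U X (Qrel s)) ?p ?z"
    using X small_quot[OF U X] kappa_surjection conn_map(1)[OF U X P Q PQ]
    by (simp add: surj_chain_def)
  then have K: "small U K" "k \<in> ?Y \<rightarrow>\<^sub>E K"
    using sel Kk unfolding select_routine_def sel_result_def by blast+
  have p: "?p \<in> X \<rightarrow> ?Y"
    using kappa_surjection[of X U "Prel s"] by (auto simp: surjection_def)
  have next_q_eq: "next_q U sel X s = compose X k ?p"
    by (simp add: next_q_def Kk)
  show "small U (next_K U sel X s)"
    using K by (simp add: next_K_def Kk)
  show "next_q U sel X s \<in> X \<rightarrow>\<^sub>E next_K U sel X s"
    using K p by (auto simp: next_q_eq next_K_def Kk compose_def)
  assume "respects_compound_blocks U sel"
  then have "equiv ?Y (kernel ?Y ?z \<union> kernel ?Y k)"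
    using chain Kk unfolding respects_compound_blocks_def sel_result_def by blast
  from equiv_preimage[OF this p]
  have "equiv X {(x, y). x \<in> X \<and> y \<in> X \<and> (?p x, ?p y) \<in> kernel ?Y ?z \<union> kernel ?Y k}" .
  also have "{(x, y). x \<in> X \<and> y \<in> X \<and> (?p x, ?p y) \<in> kernel ?Y ?z \<union> kernel ?Y k} =
      Qrel s \<union> kernel X (next_q U sel X s)"
    using p Q conn_map(2)[OF U X P Q PQ] kappa_eq_iff[OF U X Q]
    by (auto simp: kernel_def next_q_eq compose_eq equiv_def)
  finally show "equiv X (Qrel s \<union> kernel X (next_q U sel X s))" .
qed

lemma Prel_run:
  "Prel (run U H sel X \<xi> i) =
     kernel X (compose X (fmap H X (Kbar (run U H sel X \<xi> i)) (qbar (run U H sel X \<xi> i))) \<xi>)"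
  by (cases i) (simp_all add: init_state_def step_def Let_def)

lemma Qrel_run: "Qrel (run U H sel X \<xi> i) = kernel X (qbar (run U H sel X \<xi> i))"
  by (cases i) (auto simp: init_state_def step_def Let_def kernel_def bang_def)

text \<open>The inclusions are assumed for \<open>j < i\<close> because the factors of
  \<open>Kbar\<close> at stage \<open>i\<close> come from selections made in the earlier
  states.\<close>

lemma qbar_run:
  assumes U: "set_universe U" and X: "small U X" and sel: "select_routine U sel"
    and PQ: "\<And>j. j < i \<Longrightarrow> Prel (run U H sel X \<xi> j) \<subseteq> Qrel (run U H sel X \<xi> j)"
  shows "small U (Kbar (run U H sel X \<xi> i)) \<and> qbar (run U H sel X \<xi> i) \<in> X \<rightarrow>\<^sub>E Kbar (run U H sel X \<xi> i)"
  using PQ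
proof (induction i)
  case 0
  show ?case
    using small_one[OF U] by (auto simp: init_state_def bang_def one_def)
next
  case (Suc i)
  let ?s = "run U H sel X \<xi> i"
  have IH: "small U (Kbar ?s)" "qbar ?s \<in> X \<rightarrow>\<^sub>E Kbar ?s"
    using Suc by simp_all
  have "equiv X (Prel ?s)" "equiv X (Qrel ?s)"
    by (simp_all only: Prel_run Qrel_run equiv_kernel)
  note q = next_q[OF U X sel this Suc.prems[OF lessI]]
  show ?case
    using small_prod_ob[OF U IH(1) q(1)]
      pairing_funcset[OF PiE_imp_Pi[OF IH(2)] PiE_imp_Pi[OF q(2)], of U]
    by (simp add: step_def Let_def)
qed

theorem theorem5p20:
  fixes U :: "'u set_univ" and H :: "('u, 'h) set_func" and sel :: "'u selector"
    and X :: "'u set" and \<xi> :: "'u \<Rightarrow> 'h" and i :: nat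
  assumes "set_universe U"
    and "set_functor U H"
    and "zippable U H"
    and "select_routine U sel"
    and "respects_compound_blocks U sel"
    and "coalgebra U H X \<xi>"
    and "executes U H sel X \<xi> i"
  shows "let s = run U H sel X \<xi> i;
             s' = run U H sel X \<xi> (Suc i);
             K = next_K U sel X s;
             q = next_q U sel X s;
             Hqbar_xi = compose X (fmap H X (Kbar s) (qbar s)) \<xi>;
             Hq_xi = compose X (fmap H X K q) \<xi>;
             P_pairing =
               kernel X (compose X (fmap H X (prod_ob U (Kbar s) K) (pairing U X (qbar s) q)) \<xi>)
         in Prel s' = P_pairing \<and>
            P_pairing = kernel X (\<lambda>x\<in>X. (Hqbar_xi x, Hq_xi x)) \<and>
            kernel X (\<lambda>x\<in>X. (Hqbar_xi x, Hq_xi x)) = Prel s \<inter> kernel X Hq_xi"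
proof -
  let ?s = "run U H sel X \<xi> i"
  let ?K = "next_K U sel X ?s" and ?q = "next_q U sel X ?s"
  have X: "small U X" and \<xi>: "\<And>x. x \<in> X \<Longrightarrow> \<xi> x \<in> fob H X"
    using assms(6) by (auto simp: coalgebra_def)
  have PQ: "Prel (run U H sel X \<xi> j) \<subseteq> Qrel (run U H sel X \<xi> j)" if "j \<le> i" for j
    using assms(7) that by (auto simp: executes_def)
  have "equiv X (Prel ?s)" "equiv X (Qrel ?s)"
    by (simp_all only: Prel_run Qrel_run equiv_kernel)
  note q = next_q[OF assms(1) X assms(4) this PQ[OF order_refl]]
  have qbar: "small U (Kbar ?s)" "qbar ?s \<in> X \<rightarrow>\<^sub>E Kbar ?s"
    using qbar_run[OF assms(1) X assms(4) PQ[OF less_imp_le]] by simp_all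
  \<comment> \<open>With \<open>Qrel\<close> rewritten as the kernel of \<open>qbar\<close>, respect
    for compound blocks becomes the equivalence hypothesis of the pairing lemma.\<close>
  note pairing_iff = fmap_pairing_eq_iff[OF assms(1-3) X qbar(1) q(1) qbar(2) q(2)
      q(3)[OF assms(5), unfolded Qrel_run] \<xi> \<xi>]
  have Prel_Suc: "Prel (run U H sel X \<xi> (Suc i)) =
      kernel X (compose X (fmap H X (prod_ob U (Kbar ?s) ?K) (pairing U X (qbar ?s) ?q)) \<xi>)"
    by (simp add: step_def Let_def)
  show ?thesis
    unfolding Let_def Prel_Suc Prel_run[of U H sel X \<xi> i]
    by (auto simp: kernel_def compose_eq pairing_iff)
qed

end
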